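(* Let $n\ge 2$ and $m\ge 1$ be integers. A weighted forest $F\in\mathcal{F}(n,m)$ has maximum energy in $\mathcal{F}(n,m)$ if and only if each connected component of $F$ is either a single vertex $K_1$ or a single edge $K_2$; in this case $\mathbb{E}(F)=2m$.
   Context: $\mathcal{F}(n,m)$ denotes the set of forests on $n$ vertices in which every edge has a positive integer weight and the sum of all edge weights equals $m$. The energy of a weighted graph $G$ is $\mathbb{E}(G)=\sum_i|\lambda_i|$, where $\lambda_i$ are the eigenvalues of the weighted adjacency matrix (the symmetric matrix whose $(i,j)$ entry is the weight of edge $ij$, or $0$ if there is no such edge). *)

theory Defs
  imports
    "Graph_Theory.Graph_Theory"
    "Jordan_Normal_Form.Spectral_Radius"
begin

text \<open>
  Undirected simple graphs are finite loop-free symmetric digraphs without parallel arcs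
  (\<^locale>\<open>pair_graph\<close>). A weight is attached to the unordered pair \<open>{u, v}\<close>, so that the two arcs
  of an undirected edge carry the same weight; values of the weight function outside the edge set
  are never used.
\<close>

type_synonym weighted_graph = "nat pair_pre_digraph \<times> (nat set \<Rightarrow> nat)"

definition edges :: "nat pair_pre_digraph \<Rightarrow> nat set set" where
  "edges G = (\<lambda>(u, v). {u, v}) ` parcs G"

text \<open>
  In a symmetric digraph the closed walk \<open>u, v, u\<close> counts as a cycle of length two, so \<^const>\<open>forest\<close>
  would exclude every edge. The cycles of the undirected graph are those with at least three arcs.
\<close>

definition undirected_forest :: "nat pair_pre_digraph \<Rightarrow> bool" where
  "undirected_forest G \<longleftrightarrow>
     pair_graph G \<and> \<not> (\<exists>p. pre_digraph.cycle (with_proj G) p \<and> length p \<ge> 3)"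

definition weighted_forests :: "nat \<Rightarrow> nat \<Rightarrow> weighted_graph set" where
  "weighted_forests n m =
     {(G, w). undirected_forest G \<and> pverts G = {0..<n} \<and>
        (\<forall>e\<in>edges G. w e > 0) \<and> (\<Sum>e\<in>edges G. w e) = m}"

text \<open>The adjacency matrix is meant for graphs whose vertex set is an initial segment \<open>{0..<n}\<close>.\<close>

definition adjacency_matrix :: "weighted_graph \<Rightarrow> real mat" where
  "adjacency_matrix = (\<lambda>(G, w). mat (card (pverts G)) (card (pverts G))
     (\<lambda>(i, j). if (i, j) \<in> parcs G then real (w {i, j}) else 0))"

text \<open>
  Eigenvalues are counted with their multiplicity as roots of the characteristic polynomial. They
  are taken over the complex numbers, so that there are always as many of them as vertices.
\<close>

definition energy :: "weighted_graph \<Rightarrow> real" where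
  "energy F = (let A = map_mat complex_of_real (adjacency_matrix F)
     in \<Sum>k\<in>spectrum A. real (Polynomial.order k (char_poly A)) * cmod k)"

text \<open>
  In a symmetric digraph the strongly connected components are the connected components of the
  undirected graph.
\<close>

definition components :: "weighted_graph \<Rightarrow> (nat, nat \<times> nat) pre_digraph set" where
  "components F = pre_digraph.sccs (with_proj (fst F))"

end

theory Submission
  imports Defs
begin

text \<open>
  For a Hermitian matrix \<open>A\<close>, the sum of the absolute values of the eigenvalues is the largest value
  of \<open>\<bar>trace (W A)\<bar>\<close> over unitary \<open>W\<close>, and it is attained. For an adjacency matrix this trace is
  the sum of \<open>W\<^sub>i\<^sub>j w\<^sub>i\<^sub>j\<close> over all arcs; since the entries of a unitary matrix are bounded by 1, the
  energy is at most \<open>2 m\<close>. In the case of equality \<open>W\<^sub>i\<^sub>j = 1\<close> for all arcs \<open>(i, j)\<close>, and as the rows of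
  \<open>W\<close> have norm 1, no vertex has two neighbours. Conversely, if the edges form a matching, the
  permutation matrix exchanging matched vertices shows that the energy is at least \<open>2 m\<close>.
\<close>

section \<open>Unitary triangularization\<close>

lemma dim_mat_adjoint [simp]:
  "dim_row (mat_adjoint A) = dim_col A" "dim_col (mat_adjoint A) = dim_row A"
  by (simp_all add: mat_adjoint_def)

lemma mat_adjoint_carrier [simp, intro]:
  "A \<in> carrier_mat n m \<Longrightarrow> mat_adjoint A \<in> carrier_mat m n"
  by (rule carrier_matI) auto

lemma index_mat_adjoint [simp]:
  assumes "i < dim_col A" "j < dim_row A"
  shows "mat_adjoint A $$ (i, j) = conjugate (A $$ (j, i))"
  using assms by (simp add: mat_adjoint_def mat_of_rows_def)

lemma mat_adjoint_mult:
  fixes A B :: "complex mat"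
  assumes "A \<in> carrier_mat n m" "B \<in> carrier_mat m k"
  shows "mat_adjoint (A * B) = mat_adjoint B * mat_adjoint A"
proof (rule eq_matI)
  fix i j
  assume "i < dim_row (mat_adjoint B * mat_adjoint A)" "j < dim_col (mat_adjoint B * mat_adjoint A)"
  then have "i < k" "j < n"
    using assms by simp_all
  then show "mat_adjoint (A * B) $$ (i, j) = (mat_adjoint B * mat_adjoint A) $$ (i, j)"
    using assms by (simp add: scalar_prod_def) (rule sum.cong, simp_all add: mult.commute)
qed (use assms in simp_all)

definition unitary_mat :: "nat \<Rightarrow> complex mat \<Rightarrow> bool" where
  "unitary_mat n U \<longleftrightarrow> U \<in> carrier_mat n n \<and> mat_adjoint U * U = 1\<^sub>m n"

text \<open>A left inverse of a square matrix is also a right inverse, which gives the third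
  fact.\<close>

lemma unitary_matD:
  assumes "unitary_mat n U"
  shows "U \<in> carrier_mat n n" "mat_adjoint U * U = 1\<^sub>m n" "U * mat_adjoint U = 1\<^sub>m n"
  using assms mat_mult_left_right_inverse[of "mat_adjoint U" n U] by (auto simp: unitary_mat_def)

lemma mat_adjoint_adjoint [simp]: "mat_adjoint (mat_adjoint A) = (A :: complex mat)"
  by (intro eq_matI) auto

lemma unitary_mat_adjoint:
  assumes "unitary_mat n U"
  shows "unitary_mat n (mat_adjoint U)"
  unfolding unitary_mat_def using unitary_matD[OF assms] by simp

lemma unitary_mat_mult:
  assumes "unitary_mat n U" "unitary_mat n V"
  shows "unitary_mat n (U * V)"
proof -
  note U = unitary_matD[OF assms(1)] and V = unitary_matD[OF assms(2)]
  have "mat_adjoint (U * V) * (U * V) = mat_adjoint V * (mat_adjoint U * U) * V"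
    using U(1) V(1)
    by (simp add: mat_adjoint_mult[of _ n n _ n] assoc_mult_mat[of _ n n _ n _ n]
        mult_carrier_mat[of _ n n _ n])
  also have "\<dots> = 1\<^sub>m n"
    unfolding U(2) using V by (simp add: right_mult_one_mat[of _ n n])
  finally show ?thesis
    using U(1) V(1) by (simp add: unitary_mat_def)
qed

text \<open>The squared norm of column \<open>j\<close> is the diagonal entry \<open>(j, j)\<close>
  of \<open>mat_adjoint U * U\<close>.\<close>

lemma unitary_mat_col_norm:
  assumes "unitary_mat n U" "j < n"
  shows "(\<Sum>i<n. (cmod (U $$ (i, j)))\<^sup>2) = 1"
proof -
  note U = unitary_matD[OF assms(1)]
  have "of_real (\<Sum>i<n. (cmod (U $$ (i, j)))\<^sup>2) = (mat_adjoint U * U) $$ (j, j)"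
    using U(1) assms(2)
    by (auto simp: scalar_prod_def complex_norm_square mult.commute lessThan_atLeast0
        simp del: of_real_power)
  then show ?thesis
    unfolding U(2) using assms(2) by (simp del: of_real_sum)
qed

text \<open>Up to conjugation, the rows of \<open>U\<close> are the columns of its adjoint, which is
  unitary as well.\<close>

lemma unitary_mat_row_norm:
  assumes "unitary_mat n U" "i < n"
  shows "(\<Sum>j<n. (cmod (U $$ (i, j)))\<^sup>2) = 1"
  using unitary_mat_col_norm[OF unitary_mat_adjoint[OF assms(1)] assms(2)]
    unitary_matD(1)[OF assms(1)] assms(2)
  by simp

lemma cmod_unitary_mat_le_1:
  assumes "unitary_mat n U" "i < n" "j < n"
  shows "cmod (U $$ (i, j)) \<le> 1"
proof -
  have "(cmod (U $$ (i, j)))\<^sup>2 \<le> (\<Sum>j<n. (cmod (U $$ (i, j)))\<^sup>2)"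
    using assms(3) by (intro member_le_sum) auto
  then show ?thesis
    using unitary_mat_row_norm[OF assms(1,2)] by (simp add: abs_square_le_1)
qed

definition trace :: "'a::comm_ring_1 mat \<Rightarrow> 'a" where
  "trace A = (\<Sum>i<dim_row A. A $$ (i, i))"

lemma trace_mult:
  assumes "A \<in> carrier_mat n m" "B \<in> carrier_mat m n"
  shows "trace (A * B) = (\<Sum>i<n. \<Sum>j<m. A $$ (i, j) * B $$ (j, i))"
  using assms by (auto simp: trace_def scalar_prod_def lessThan_atLeast0)

lemma trace_mult_comm:
  assumes "A \<in> carrier_mat n m" "B \<in> carrier_mat m n"
  shows "trace (A * B) = trace (B * A)"
  unfolding trace_mult[OF assms] trace_mult[OF assms(2,1)]
  by (subst sum.swap) (simp add: mult.commute)

text \<open>Complete \<open>v\<close> to a basis, orthogonalize by Gram-Schmidt, which keeps the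
  first vector, and normalize; the results are the columns of \<open>W\<close>. The scalar
  \<open>c\<close> is the inverse of the norm of \<open>v\<close>.\<close>

lemma unitary_mat_with_first_col:
  assumes v: "v \<in> carrier_vec n" and v0: "v \<noteq> 0\<^sub>v n"
  obtains W c where "unitary_mat n W" "col W 0 = c \<cdot>\<^sub>v v"
proof -
  interpret cof_vec_space n "TYPE(complex)" .
  define ws where "ws = gram_schmidt n (basis_completion v)"
  note b = basis_completion[OF v v0]
  have n: "n \<noteq> 0"
    using v v0 by (auto simp: vec_eq_iff)
  then obtain vs where bv: "basis_completion v = v # vs"
    using b(6,7) by (cases "basis_completion v") auto
  note gs = gram_schmidt_result[OF b(2,4,5) ws_def]
  have len: "length ws = n"
    using gs(4) b(6) by simp
  have hd: "ws ! 0 = v"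
    using gram_schmidt_hd[OF v, of vs, folded bv, folded ws_def] len n hd_conv_nth[of ws] by force
  have carr: "ws ! i \<in> carrier_vec n" if "i < n" for i
    using gs(3) that len by auto
  \<comment> \<open>Gram-Schmidt yields orthogonal vectors that need not have norm 1;
    \<open>c i\<close> is the inverse of the norm of \<open>ws ! i\<close>. It is real, so
    conjugation in the adjoint does not change it.\<close>
  define c :: "nat \<Rightarrow> complex" where "c i = of_real (1 / sqrt (Re (ws ! i \<bullet>c ws ! i)))" for i
  have cnj_c: "cnj (c i) = c i" for i
    by (simp add: c_def)
  define W where "W = mat n n (\<lambda>(k, i). c i * ws ! i $ k)"
  \<comment> \<open>In the order on the complex numbers, positivity also says that the value is
    real.\<close>
  have pos: "ws ! i \<bullet>c ws ! i > 0" if "i < n" for i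
    using corthogonalD[OF gs(2), of i i] conjugate_square_ge_0_vec[of "ws ! i"] that len
    by (auto simp: less_le)
  have "mat_adjoint W * W = 1\<^sub>m n"
  proof (rule eq_matI)
    fix i j
    assume "i < dim_row (1\<^sub>m n :: complex mat)" "j < dim_col (1\<^sub>m n :: complex mat)"
    then have i: "i < n" and j: "j < n"
      by simp_all
    have "(mat_adjoint W * W) $$ (i, j) = c i * c j * (ws ! j \<bullet>c ws ! i)"
      using i j carr[OF i] carr[OF j]
      by (simp add: W_def scalar_prod_def sum_distrib_left cnj_c mult_ac)
    also have "\<dots> = 1\<^sub>m n $$ (i, j)"
    proof (cases "i = j")
      case True
      define r where "r = Re (ws ! i \<bullet>c ws ! i)"
      have r: "r > 0" and ws_r: "ws ! i \<bullet>c ws ! i = of_real r"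
        using pos[OF i] by (simp_all add: r_def less_complex_def complex_eq_iff)
      have "c i * c i = of_real (1 / r)"
        using r by (simp add: c_def flip: r_def of_real_mult)
      then have "c i * c i * (ws ! i \<bullet>c ws ! i) = 1"
        using r by (simp add: ws_r)
      then show ?thesis
        using True i by simp
    next
      case False
      then show ?thesis
        using corthogonalD[OF gs(2), of j i] i j len by simp
    qed
    finally show "(mat_adjoint W * W) $$ (i, j) = 1\<^sub>m n $$ (i, j)" .
  qed (simp_all add: W_def)
  then have "unitary_mat n W"
    by (simp add: unitary_mat_def W_def)
  moreover have "col W 0 = c 0 \<cdot>\<^sub>v v"
    using n v hd by (auto simp: W_def)
  ultimately show ?thesis
    by (rule that)
qed

lemma mat_adjoint_four_block_diag:
  fixes A D :: "complex mat"
  assumes "A \<in> carrier_mat n n" "D \<in> carrier_mat m m"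
  shows "mat_adjoint (four_block_mat A (0\<^sub>m n m) (0\<^sub>m m n) D) =
    four_block_mat (mat_adjoint A) (0\<^sub>m n m) (0\<^sub>m m n) (mat_adjoint D)"
  using assms by (intro eq_matI) auto

lemma one_four_block_mat: "four_block_mat (1\<^sub>m n) (0\<^sub>m n m) (0\<^sub>m m n) (1\<^sub>m m) = 1\<^sub>m (n + m)"
  by (intro eq_matI) auto

text \<open>Induction on the dimension. A unitary \<open>W\<close> whose first column is an
  eigenvector turns the first column of \<open>A\<close> into a multiple of the first unit vector;
  the induction hypothesis triangularizes the remaining lower right block.\<close>

lemma unitary_schur:
  assumes "A \<in> carrier_mat n n"
  obtains U where "unitary_mat n U" "upper_triangular (mat_adjoint U * A * U)"
  using assms
proof (induction n arbitrary: A thesis)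
  case 0
  then show ?case
    by (intro 0(1)[of "1\<^sub>m 0"]) (auto simp: unitary_mat_def)
next
  case (Suc n)
  note A = Suc.prems(2)
  obtain e where "eigenvalue A e"
    using spectrum_non_empty[OF A] by (auto simp: spectrum_def)
  then obtain v where v: "v \<in> carrier_vec (Suc n)" "v \<noteq> 0\<^sub>v (Suc n)" "A *\<^sub>v v = e \<cdot>\<^sub>v v"
    using A by (auto simp: eigenvalue_def eigenvector_def)
  obtain W c where W: "unitary_mat (Suc n) W" "col W 0 = c \<cdot>\<^sub>v v"
    using unitary_mat_with_first_col[OF v(1,2)] by blast
  note W' = unitary_matD[OF W(1)]
  define B where "B = mat_adjoint W * A * W"
  have B: "B \<in> carrier_mat (Suc n) (Suc n)"
    unfolding B_def using A W'(1) by (intro mult_carrier_mat) auto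
  \<comment> \<open>The first column of \<open>A * W\<close> is \<open>e\<close> times that of
    \<open>W\<close>, and \<open>mat_adjoint W\<close> maps the first column of \<open>W\<close> to
    the first unit vector.\<close>
  have B0: "B $$ (i, 0) = (if i = 0 then e else 0)" if i: "i < Suc n" for i
  proof -
    have AW: "col (A * W) 0 = e \<cdot>\<^sub>v col W 0"
    proof -
      have "col (A * W) 0 = A *\<^sub>v (c \<cdot>\<^sub>v v)"
        using col_mult2[OF A W'(1), of 0] W(2) by simp
      also have "\<dots> = e \<cdot>\<^sub>v (c \<cdot>\<^sub>v v)"
        using A v by (simp add: mult_mat_vec smult_smult_assoc mult.commute)
      finally show ?thesis
        using W(2) by simp
    qed
    have "B $$ (i, 0) = (mat_adjoint W * (A * W)) $$ (i, 0)"
      using A W' by (simp add: B_def assoc_mult_mat[of _ "Suc n" "Suc n" _ "Suc n" _ "Suc n"])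
    also have "\<dots> = row (mat_adjoint W) i \<bullet> (e \<cdot>\<^sub>v col W 0)"
      using A W' i AW by simp
    also have "\<dots> = e * (row (mat_adjoint W) i \<bullet> col W 0)"
      using W' i by (simp add: scalar_prod_smult_distrib[of _ "Suc n"])
    also have "row (mat_adjoint W) i \<bullet> col W 0 = (mat_adjoint W * W) $$ (i, 0)"
      using W'(1) i by simp
    also have "e * \<dots> = (if i = 0 then e else 0)"
      unfolding W'(2) using i by simp
    finally show ?thesis .
  qed
  obtain B1 B2 B0 B3 where split: "split_block B 1 1 = (B1, B2, B0, B3)"
    by (cases "split_block B 1 1") auto
  have carr: "B1 \<in> carrier_mat 1 1" "B2 \<in> carrier_mat 1 n" "B3 \<in> carrier_mat n n"
    and B_block: "B = four_block_mat B1 B2 B0 B3"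
    using split_block[OF split, of n n] B by auto
  have "B0 = 0\<^sub>m n 1"
    using split B B0 by (auto simp: split_block_def Let_def)
  note B_block = B_block[unfolded this]
  obtain V where V: "unitary_mat n V" "upper_triangular (mat_adjoint V * B3 * V)"
    using Suc.IH[OF _ carr(3)] by blast
  note V' = unitary_matD[OF V(1)]
  \<comment> \<open>Bordering \<open>V\<close> with a 1 in the corner makes conjugation by
    \<open>P\<close> act as \<open>V\<close> on the block \<open>B3\<close> while preserving the
    zeros below the corner.\<close>
  define P where "P = four_block_mat (1\<^sub>m 1) (0\<^sub>m 1 n) (0\<^sub>m n 1) V"
  have one: "mat_adjoint (1\<^sub>m k) = (1\<^sub>m k :: complex mat)" for k
    by (intro eq_matI) auto
  have P_adj: "mat_adjoint P = four_block_mat (1\<^sub>m 1) (0\<^sub>m 1 n) (0\<^sub>m n 1) (mat_adjoint V)"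
    unfolding P_def using V' by (simp add: mat_adjoint_four_block_diag one)
  have "mat_adjoint P * P = 1\<^sub>m (Suc n)"
    unfolding P_adj unfolding P_def using V' one_four_block_mat[of 1 n]
    by (subst mult_four_block_mat[of _ 1 1 _ n _ n _ _ 1 _ n]) auto
  then have P: "unitary_mat (Suc n) P"
    using V' by (auto simp: unitary_mat_def P_def)
  note P' = unitary_matD[OF P]
  have "mat_adjoint P * B * P = four_block_mat B1 (B2 * V) (0\<^sub>m n 1) (mat_adjoint V * B3 * V)"
    unfolding P_adj B_block unfolding P_def using V' carr
    by (subst mult_four_block_mat[of _ 1 1 _ n _ n _ _ 1 _ n], (auto)[8])
      (subst mult_four_block_mat[of _ 1 1 _ n _ n _ _ 1 _ n],
        auto simp: left_add_zero_mat[of _ n n] mult_carrier_mat[of _ n n _ n])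
  moreover have "upper_triangular B1"
    using carr(1) by auto
  ultimately have "upper_triangular (mat_adjoint P * B * P)"
    using upper_triangular_four_block[of B1 1 "mat_adjoint V * B3 * V" n] carr V V'
    by (simp add: mult_carrier_mat[of _ n n _ n])
  also have "mat_adjoint P * B * P = mat_adjoint (W * P) * A * (W * P)"
    unfolding B_def using A W'(1) P'(1)
    by (simp add: mat_adjoint_mult[of _ "Suc n" "Suc n" _ "Suc n"]
        assoc_mult_mat[of _ "Suc n" "Suc n" _ "Suc n" _ "Suc n"]
        mult_carrier_mat[of _ "Suc n" "Suc n" _ "Suc n"])
  finally show ?case
    by (rule Suc.prems(1)[OF unitary_mat_mult[OF W(1) P]])
qed


text \<open>The Schur form of a Hermitian matrix is again Hermitian, so the zeros below its diagonal
  reappear above it.\<close>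

lemma hermitian_diagonalization:
  assumes A: "A \<in> carrier_mat n n" and herm: "mat_adjoint A = A"
  obtains U where "unitary_mat n U" "diagonal_mat (mat_adjoint U * A * U)"
proof -
  obtain U where U: "unitary_mat n U" and upper: "upper_triangular (mat_adjoint U * A * U)"
    using unitary_schur[OF A] .
  note U' = unitary_matD(1)[OF U]
  define D where "D = mat_adjoint U * A * U"
  have D: "D \<in> carrier_mat n n"
    unfolding D_def using A U' by (intro mult_carrier_mat) auto
  have "mat_adjoint D = D"
    unfolding D_def using A U' herm
    by (simp add: mat_adjoint_mult[of _ n n _ n] assoc_mult_mat[of _ n n _ n _ n]
        mult_carrier_mat[of _ n n _ n])
  have "D $$ (i, j) = 0" if "i < n" "j < n" "i \<noteq> j" for i j
  proof (cases "j < i")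
    case True
    then show ?thesis
      using upper that D by (auto simp: D_def[symmetric])
  next
    case False
    then have "D $$ (j, i) = 0"
      using upper that D by (auto simp: D_def[symmetric])
    then have "mat_adjoint D $$ (i, j) = 0"
      using that D by simp
    then show ?thesis
      by (simp add: \<open>mat_adjoint D = D\<close>)
  qed
  then have "diagonal_mat D"
    using D by (auto simp: diagonal_mat_def)
  then show thesis
    using that U by (simp add: D_def)
qed

section \<open>The sum of the absolute values of the eigenvalues\<close>

text \<open>The order of a root is additive over nonzero factors, and \<open>[:- a, 1:]\<close>
  contributes 1 exactly at \<open>a\<close>.\<close>

lemma order_prod_linear:
  "order k (\<Prod>a\<leftarrow>as. [:- a, 1:]) = count_list as (k :: 'a::field)"
proof (induction as)
  case (Cons a as)
  have "(\<Prod>a\<leftarrow>as. [:- a, 1:]) \<noteq> 0"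
    by (auto simp: prod_list_zero_iff)
  then have "order k ([:- a, 1:] * (\<Prod>a\<leftarrow>as. [:- a, 1:])) =
      order k [:- a, 1:] + order k (\<Prod>a\<leftarrow>as. [:- a, 1:])"
    by (intro order_mult) (simp del: mult_pCons_left)
  also have "order k [:- a, 1:] = (if k = a then 1 else 0)"
    using order_linear_power[of k "- a" 1] by simp
  finally show ?case
    using Cons.IH by simp
qed simp

text \<open>Serves to turn a sum over the spectrum, weighted by multiplicities, into a sum over the
  list of diagonal entries of a triangular form.\<close>

lemma sum_count_list:
  assumes "finite S" "set xs \<subseteq> S"
  shows "(\<Sum>x\<in>S. real (count_list xs x) * f x) = (\<Sum>x\<leftarrow>xs. f x)"
  using assms(2)
proof (induction xs)
  case (Cons a xs)
  have "(\<Sum>x\<in>S. real (count_list (a # xs) x) * f x) =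
      (\<Sum>x\<in>S. (if x = a then f x else 0) + real (count_list xs x) * f x)"
    by (intro sum.cong) (auto simp: algebra_simps)
  then show ?case
    using Cons assms(1) by (simp add: sum.distrib)
qed simp

text \<open>For Hermitian \<open>A\<close> this is the trace norm.\<close>

definition abs_eigenvalue_sum :: "complex mat \<Rightarrow> real" where
  "abs_eigenvalue_sum A = (\<Sum>k\<in>spectrum A. real (order k (char_poly A)) * cmod k)"

text \<open>Similar matrices share their characteristic polynomial, and that of \<open>B\<close>
  splits into the linear factors of its diagonal entries, so the diagonal lists the eigenvalues with
  multiplicity.\<close>

lemma abs_eigenvalue_sum_upper_triangular:
  assumes "A \<in> carrier_mat n n" "similar_mat A B" "upper_triangular B"
  shows "abs_eigenvalue_sum A = (\<Sum>i<n. cmod (B $$ (i, i)))"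
proof -
  have B: "B \<in> carrier_mat n n"
    using similar_matD[OF assms(2)] assms(1) by auto
  then have char_poly: "char_poly A = (\<Prod>a\<leftarrow>diag_mat B. [:- a, 1:])"
    using char_poly_similar[OF assms(2)] char_poly_upper_triangular[OF _ assms(3)] by metis
  have "set (diag_mat B) \<subseteq> spectrum A"
    unfolding spectrum_root_char_poly[OF assms(1)] char_poly
    by (auto simp: poly_prod_list prod_list_zero_iff)
  then have "abs_eigenvalue_sum A = (\<Sum>a\<leftarrow>diag_mat B. cmod a)"
    unfolding abs_eigenvalue_sum_def char_poly order_prod_linear
    using sum_count_list card_finite_spectrum(1)[OF assms(1)] by blast
  also have "\<dots> = (\<Sum>i<n. cmod (B $$ (i, i)))"
    using B by (simp add: diag_mat_def comp_def interv_sum_list_conv_sum_set_nat lessThan_atLeast0)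
  finally show ?thesis .
qed

lemma hermitian_eigenvalue_decomposition:
  assumes A: "A \<in> carrier_mat n n" and herm: "mat_adjoint A = A"
  obtains U D where "unitary_mat n U" "D \<in> carrier_mat n n" "diagonal_mat D"
    "A = U * D * mat_adjoint U" "abs_eigenvalue_sum A = (\<Sum>i<n. cmod (D $$ (i, i)))"
proof -
  obtain U where U: "unitary_mat n U" and diag: "diagonal_mat (mat_adjoint U * A * U)"
    using hermitian_diagonalization[OF assms] .
  note U' = unitary_matD[OF U]
  define D where "D = mat_adjoint U * A * U"
  have D: "D \<in> carrier_mat n n"
    unfolding D_def using A U' by (intro mult_carrier_mat) auto
  have "U * D * mat_adjoint U = (U * mat_adjoint U) * A * (U * mat_adjoint U)"
    unfolding D_def using A U'(1)
    by (simp add: assoc_mult_mat[of _ n n _ n _ n] mult_carrier_mat[of _ n n _ n])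
  then have decomp: "A = U * D * mat_adjoint U"
    unfolding U'(3) using A by simp
  then have "similar_mat_wit A D U (mat_adjoint U)"
    using similar_mat_witI[OF U'(3,2) decomp A D] U'(1) by simp
  then have "similar_mat A D"
    by (auto simp: similar_mat_def)
  moreover have "upper_triangular D"
    using diag D unfolding diagonal_mat_def D_def[symmetric] by auto
  ultimately show thesis
    using that[OF U D _ decomp] abs_eigenvalue_sum_upper_triangular[OF A] diag
    by (simp add: D_def)
qed

lemma trace_mult_diagonal:
  assumes "X \<in> carrier_mat n n" "D \<in> carrier_mat n n" "diagonal_mat D"
  shows "trace (X * D) = (\<Sum>i<n. X $$ (i, i) * D $$ (i, i))"
proof -
  have "(\<Sum>j<n. X $$ (i, j) * D $$ (j, i)) = X $$ (i, i) * D $$ (i, i)" if "i < n" for i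
  proof -
    have "(\<Sum>j<n. X $$ (i, j) * D $$ (j, i)) =
        (\<Sum>j<n. if j = i then X $$ (i, i) * D $$ (i, i) else 0)"
      using assms that by (intro sum.cong) (auto simp: diagonal_mat_def)
    then show ?thesis
      using that by simp
  qed
  then show ?thesis
    unfolding trace_mult[OF assms(1,2)] by simp
qed

text \<open>Write \<open>A = U * D * mat_adjoint U\<close>. Cyclicity of the trace turns
  \<open>trace (P * A)\<close> into \<open>trace (V * D)\<close> with \<open>V\<close> unitary, and
  the diagonal entries of \<open>V\<close> have modulus at most 1.\<close>

lemma cmod_trace_unitary_mult_le:
  assumes A: "A \<in> carrier_mat n n" and herm: "mat_adjoint A = A" and P: "unitary_mat n P"
  shows "cmod (trace (P * A)) \<le> abs_eigenvalue_sum A"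
proof -
  obtain U D where U: "unitary_mat n U" and D: "D \<in> carrier_mat n n" "diagonal_mat D"
    and decomp: "A = U * D * mat_adjoint U"
    and sum: "abs_eigenvalue_sum A = (\<Sum>i<n. cmod (D $$ (i, i)))"
    using hermitian_eigenvalue_decomposition[OF A herm] .
  note U' = unitary_matD(1)[OF U] and P' = unitary_matD(1)[OF P]
  define V where "V = mat_adjoint U * P * U"
  have V: "unitary_mat n V"
    unfolding V_def by (intro unitary_mat_mult unitary_mat_adjoint U P)
  have "trace (P * A) = trace ((P * U * D) * mat_adjoint U)"
    unfolding decomp using U' P' D(1)
    by (simp add: assoc_mult_mat[of _ n n _ n _ n] mult_carrier_mat[of _ n n _ n])
  also have "\<dots> = trace (mat_adjoint U * (P * U * D))"
    using U' P' D(1) by (intro trace_mult_comm[of _ n n]) (auto intro!: mult_carrier_mat)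
  also have "mat_adjoint U * (P * U * D) = V * D"
    unfolding V_def using U' P' D(1)
    by (simp add: assoc_mult_mat[of _ n n _ n _ n] mult_carrier_mat[of _ n n _ n])
  also have "trace (V * D) = (\<Sum>i<n. V $$ (i, i) * D $$ (i, i))"
    by (rule trace_mult_diagonal[OF unitary_matD(1)[OF V] D])
  finally have "cmod (trace (P * A)) \<le> (\<Sum>i<n. cmod (V $$ (i, i) * D $$ (i, i)))"
    by (simp add: norm_sum)
  also have "\<dots> \<le> (\<Sum>i<n. cmod (D $$ (i, i)))"
    using cmod_unitary_mat_le_1[OF V]
    by (intro sum_mono) (auto simp: norm_mult intro: mult_left_le_one_le)
  finally show ?thesis
    by (simp add: sum)
qed

text \<open>In an eigenbasis, \<open>W\<close> multiplies each eigenvalue by its conjugate phase, so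
  that \<open>W * A\<close> is the positive semidefinite part of the polar decomposition of
  \<open>A\<close>.\<close>

lemma abs_eigenvalue_sum_eq_trace:
  assumes A: "A \<in> carrier_mat n n" and herm: "mat_adjoint A = A"
  obtains W where "unitary_mat n W" "of_real (abs_eigenvalue_sum A) = trace (W * A)"
proof -
  obtain U D where U: "unitary_mat n U" and D: "D \<in> carrier_mat n n" "diagonal_mat D"
    and decomp: "A = U * D * mat_adjoint U"
    and sum: "abs_eigenvalue_sum A = (\<Sum>i<n. cmod (D $$ (i, i)))"
    using hermitian_eigenvalue_decomposition[OF A herm] .
  note U' = unitary_matD[OF U]
  \<comment> \<open>The conjugate phase of the eigenvalue. Since \<open>sgn 0 = 0\<close>, zero
    eigenvalues get the phase 1, which keeps \<open>S\<close> unitary.\<close>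
  define s where "s i = (if D $$ (i, i) = 0 then 1 else cnj (sgn (D $$ (i, i))))" for i
  define S where "S = mat n n (\<lambda>(i, j). if i = j then s i else 0)"
  have S: "S \<in> carrier_mat n n"
    by (simp add: S_def)
  have norm_s: "cmod (s i) = 1" for i
    by (simp add: s_def norm_sgn)
  have s_mult: "s i * D $$ (i, i) = of_real (cmod (D $$ (i, i)))" for i
    by (simp add: s_def sgn_eq mult.commute[of "cnj _"] complex_norm_square[symmetric] power2_eq_square)
  have "mat_adjoint S * S = 1\<^sub>m n"
  proof (rule eq_matI)
    fix i j
    assume "i < dim_row (1\<^sub>m n :: complex mat)" "j < dim_col (1\<^sub>m n :: complex mat)"
    then have i: "i < n" and j: "j < n"
      by simp_all
    have "(mat_adjoint S * S) $$ (i, j) =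
        (\<Sum>k\<in>{0..<n}. cnj (if k = i then s k else 0) * (if k = j then s k else 0))"
      using i j by (simp add: S_def scalar_prod_def)
    also have "\<dots> = (\<Sum>k\<in>{0..<n}. if k = i then (if i = j then cnj (s i) * s i else 0) else 0)"
      by (intro sum.cong) auto
    finally have "(mat_adjoint S * S) $$ (i, j) = \<dots>" .
    then show "(mat_adjoint S * S) $$ (i, j) = 1\<^sub>m n $$ (i, j)"
      using i j by (simp add: norm_s mult.commute[of "cnj _"] flip: complex_norm_square)
  qed (simp_all add: S_def)
  then have "unitary_mat n S"
    using S by (simp add: unitary_mat_def)
  define W where "W = U * S * mat_adjoint U"
  have W: "unitary_mat n W"
    unfolding W_def by (intro unitary_mat_mult unitary_mat_adjoint U \<open>unitary_mat n S\<close>)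
  have "W * A = U * S * (mat_adjoint U * U) * D * mat_adjoint U"
    unfolding W_def decomp using U'(1) S D(1)
    by (simp add: assoc_mult_mat[of _ n n _ n _ n] mult_carrier_mat[of _ n n _ n])
  also have "\<dots> = U * (S * D * mat_adjoint U)"
    unfolding U'(2) using U'(1) S D(1)
    by (simp add: assoc_mult_mat[of _ n n _ n _ n] mult_carrier_mat[of _ n n _ n])
  \<comment> \<open>Cyclicity moves \<open>U\<close> to the right, where it cancels against its
    adjoint.\<close>
  finally have "trace (W * A) = trace ((S * D * mat_adjoint U) * U)"
    using U'(1) S D(1) trace_mult_comm[of U n n "S * D * mat_adjoint U"]
    by (simp add: mult_carrier_mat[of _ n n _ n])
  also have "S * D * mat_adjoint U * U = S * D * (mat_adjoint U * U)"
    using U'(1) S D(1) by (simp add: assoc_mult_mat[of _ n n _ n _ n] mult_carrier_mat[of _ n n _ n])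
  also have "\<dots> = S * D"
    unfolding U'(2) using S D(1) by (simp add: mult_carrier_mat[of _ n n _ n])
  also have "trace (S * D) = (\<Sum>i<n. S $$ (i, i) * D $$ (i, i))"
    by (rule trace_mult_diagonal[OF S D])
  also have "\<dots> = (\<Sum>i<n. of_real (cmod (D $$ (i, i))))"
    by (intro sum.cong) (simp_all add: S_def s_mult)
  finally show thesis
    using that[OF W] by (simp add: sum)
qed

section \<open>Graphs with small components\<close>

text \<open>The induced subgraph is again the projection of a pair digraph, so completeness can be
  read off its set of arcs.\<close>

lemma complete_digraph_induce_subgraph:
  "complete_digraph k (with_proj G \<restriction> S) \<longleftrightarrow>
    finite S \<and> card S = k \<and> parcs G \<inter> S \<times> S = {(u, v). u \<in> S \<and> v \<in> S \<and> u \<noteq> v}"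
proof -
  have "with_proj G \<restriction> S = with_proj \<lparr>pverts = S, parcs = parcs G \<inter> S \<times> S\<rparr>"
    by (auto simp: induce_subgraph_def with_proj_def)
  then show ?thesis
    by (simp add: complete_digraph_pair_def)
qed

context pair_graph
begin

lemma arc_sym: "(u, v) \<in> parcs G \<longleftrightarrow> (v, u) \<in> parcs G"
  using pair_sym_arcs by (auto simp: symmetric_def dest: symD)

text \<open>As the arc relation is symmetric, single-valuedness says that the edges form a matching:
  the only arc from \<open>x\<close> leads to \<open>y\<close> and the only arc from
  \<open>y\<close> leads back.\<close>

lemma reachable_single_valued:
  assumes "single_valued (parcs G)" "(x, y) \<in> parcs G" "x \<rightarrow>\<^sup>*\<^bsub>with_proj G\<^esub> v"
  shows "v \<in> {x, y}"
  using assms(3)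
proof (induction rule: reachable_induct)
  case (step u v)
  then show ?case
    using assms(1,2) arc_sym by (auto dest: single_valuedD)
qed simp

lemma reachable_isolated:
  assumes "x \<notin> Domain (parcs G)" "x \<rightarrow>\<^sup>*\<^bsub>with_proj G\<^esub> v"
  shows "v = x"
  using assms(2)
proof (induction rule: reachable_induct)
  case (step u v)
  then show ?case
    using assms(1) by auto
qed simp

text \<open>A component with a second vertex contains a vertex \<open>x\<close> with a neighbour
  \<open>y\<close>, and nothing outside \<open>{x, y}\<close> can be reached from
  \<open>x\<close>.\<close>

lemma single_valued_imp_small_sccs:
  assumes "single_valued (parcs G)" "C \<in> sccs"
  shows "complete_digraph 1 C \<or> complete_digraph 2 C"
proof -
  obtain S where C: "C = with_proj G \<restriction> S" and "S \<in> sccs_verts"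
    using assms(2) unfolding sccs_conv_sccs_verts by auto
  then have reach: "u \<rightarrow>\<^sup>*\<^bsub>with_proj G\<^esub> v" if "u \<in> S" "v \<in> S" for u v
    using that by (auto simp: sccs_verts_def)
  have no_loop: "(u, u) \<notin> parcs G" for u
    using pair_no_loops[of "(u, u)"] by auto
  obtain x where x: "x \<in> S"
    using \<open>S \<in> sccs_verts\<close> by (auto simp: sccs_verts_def)
  show ?thesis
  proof (cases "S = {x}")
    case True
    then have "complete_digraph 1 C"
      using no_loop by (auto simp: C complete_digraph_induce_subgraph)
    then show ?thesis ..
  next
    case False
    then obtain z where z: "z \<in> S" "z \<noteq> x"
      using x by auto
    \<comment> \<open>Without an outgoing arc, \<open>x\<close> could reach only itself and not
      \<open>z\<close>.\<close>
    then obtain y where y: "(x, y) \<in> parcs G"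
      using reachable_isolated reach x by blast
    then have "S \<subseteq> {x, y}"
      using reachable_single_valued[OF assms(1)] reach x by blast
    then have S: "S = {x, y}" and "x \<noteq> y"
      using z x by auto
    then have "complete_digraph 2 C"
      using no_loop y arc_sym[of x y]
      by (auto simp: C complete_digraph_induce_subgraph)
    then show ?thesis ..
  qed
qed

text \<open>Two distinct neighbours of \<open>x\<close> would give three vertices in the component
  of \<open>x\<close>.\<close>

lemma small_sccs_imp_single_valued:
  assumes "\<And>C. C \<in> sccs \<Longrightarrow> complete_digraph 1 C \<or> complete_digraph 2 C"
  shows "single_valued (parcs G)"
proof (rule single_valuedI, rule ccontr)
  fix x y z
  assume arcs: "(x, y) \<in> parcs G" "(x, z) \<in> parcs G" and "y \<noteq> z"
  define S where "S = {v. x \<rightarrow>\<^sup>*\<^bsub>with_proj G\<^esub> v}"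
  \<comment> \<open>Reachability is symmetric here, so all that can be reached from \<open>x\<close>
    forms a strongly connected component.\<close>
  have "with_proj G \<restriction> S \<in> sccs"
    unfolding S_def using arcs by (intro induce_reachable_is_in_sccs in_arcsD1)
  then have "finite S" "card S \<le> 2"
    using assms[of "with_proj G \<restriction> S"] by (auto simp: complete_digraph_induce_subgraph)
  moreover have "{x, y, z} \<subseteq> S"
    using arcs by (auto simp: S_def intro: in_arcsD1)
  moreover have "card {x, y, z} = 3"
    using arcs \<open>y \<noteq> z\<close> pair_no_loops[of "(x, y)"] pair_no_loops[of "(x, z)"] by auto
  ultimately show False
    using card_mono[of S "{x, y, z}"] by simp
qed

end

lemma small_components_iff_single_valued:
  assumes "pair_graph G"
  shows "(\<forall>C\<in>components (G, w). complete_digraph 1 C \<or> complete_digraph 2 C) \<longleftrightarrow>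
    single_valued (parcs G)"
  using pair_graph.single_valued_imp_small_sccs[OF assms]
    pair_graph.small_sccs_imp_single_valued[OF assms]
  by (auto simp: components_def)

text \<open>The fibre of arcs over an edge \<open>{u, v}\<close> consists of \<open>(u, v)\<close>
  and \<open>(v, u)\<close>, which differ because there are no loops.\<close>

lemma sum_arcs_eq_sum_edges:
  fixes f :: "nat set \<Rightarrow> 'a::comm_semiring_1"
  assumes "pair_graph G"
  shows "(\<Sum>(u, v)\<in>parcs G. f {u, v}) = 2 * (\<Sum>e\<in>edges G. f e)"
proof -
  interpret pair_graph G by fact
  let ?h = "\<lambda>(u, v). {u, v :: nat}"
  have card: "card {a \<in> parcs G. ?h a = e} = 2" if e: "e \<in> edges G" for e
  proof -
    obtain u v where uv: "(u, v) \<in> parcs G" "e = {u, v}"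
      using e by (auto simp: edges_def)
    then have "{a \<in> parcs G. ?h a = e} = {(u, v), (v, u)}"
      using arc_sym by (auto simp: doubleton_eq_iff)
    moreover have "u \<noteq> v"
      using pair_no_loops[OF uv(1)] by simp
    ultimately show ?thesis
      by simp
  qed
  have "(\<Sum>(u, v)\<in>parcs G. f {u, v}) = (\<Sum>a\<in>parcs G. f (?h a))"
    by (simp add: case_prod_beta)
  also have "\<dots> = (\<Sum>e\<in>edges G. \<Sum>a\<in>{a \<in> parcs G. ?h a = e}. f (?h a))"
    unfolding edges_def by (rule sum.image_gen[OF pair_finite_arcs])
  also have "\<dots> = (\<Sum>e\<in>edges G. \<Sum>a\<in>{a \<in> parcs G. ?h a = e}. f e)"
    by (intro sum.cong) auto
  also have "\<dots> = (\<Sum>e\<in>edges G. 2 * f e)"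
    by (intro sum.cong refl) (simp only: sum_constant card, simp)
  finally show ?thesis
    by (simp add: sum_distrib_left)
qed

section \<open>The energy of weighted forests\<close>

locale weighted_forest =
  fixes n m :: nat and G :: "nat pair_pre_digraph" and w :: "nat set \<Rightarrow> nat"
  assumes in_weighted_forests: "(G, w) \<in> weighted_forests n m"
begin

sublocale pair_graph G
  using in_weighted_forests by (simp add: weighted_forests_def undirected_forest_def)

lemma verts_eq: "pverts G = {0..<n}"
  using in_weighted_forests by (simp add: weighted_forests_def)

lemma arc_less: "(u, v) \<in> parcs G \<Longrightarrow> u < n" "(u, v) \<in> parcs G \<Longrightarrow> v < n"
  using in_arcsD1 in_arcsD2 verts_eq by auto

lemma weight_pos: "(u, v) \<in> parcs G \<Longrightarrow> w {u, v} > 0"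
  using in_weighted_forests by (force simp: weighted_forests_def edges_def)

lemma sum_arc_weights: "(\<Sum>(u, v)\<in>parcs G. real (w {u, v})) = 2 * real m"
  using in_weighted_forests sum_arcs_eq_sum_edges[OF pair_graph_axioms, of "\<lambda>e. real (w e)"]
  by (simp add: weighted_forests_def flip: of_nat_sum)

definition adj :: "complex mat" where
  "adj = map_mat complex_of_real (adjacency_matrix (G, w))"

lemma adj_carrier: "adj \<in> carrier_mat n n"
  by (simp add: adj_def adjacency_matrix_def verts_eq)

lemma adj_index:
  "i < n \<Longrightarrow> j < n \<Longrightarrow> adj $$ (i, j) = (if (i, j) \<in> parcs G then of_nat (w {i, j}) else 0)"
  by (simp add: adj_def adjacency_matrix_def verts_eq)

lemma adj_hermitian: "mat_adjoint adj = adj"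
  using adj_carrier by (intro eq_matI) (auto simp: adj_index arc_sym insert_commute)

lemma energy_eq: "energy (G, w) = abs_eigenvalue_sum adj"
  by (simp add: energy_def adj_def abs_eigenvalue_sum_def Let_def)

lemma trace_mult_adj:
  assumes "X \<in> carrier_mat n n"
  shows "trace (X * adj) = (\<Sum>(i, j)\<in>parcs G. X $$ (i, j) * of_nat (w {i, j}))"
proof -
  have "trace (X * adj) = (\<Sum>(i, j)\<in>{..<n} \<times> {..<n}. X $$ (i, j) * adj $$ (j, i))"
    by (simp add: trace_mult[OF assms adj_carrier] sum.cartesian_product)
  also have "\<dots> = (\<Sum>(i, j)\<in>parcs G. X $$ (i, j) * of_nat (w {i, j}))"
  proof (rule sum.mono_neutral_cong_right)
    show "parcs G \<subseteq> {..<n} \<times> {..<n}"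
      using arc_less by auto
    \<comment> \<open>The trace produces the transposed index \<open>(j, i)\<close>; the reverse arc
      is present too and carries the same weight.\<close>
    have arc: "X $$ (i, j) * adj $$ (j, i) = X $$ (i, j) * of_nat (w {i, j})"
      if "(i, j) \<in> parcs G" for i j
      using adj_index[OF arc_less(2)[OF that] arc_less(1)[OF that]] that arc_sym[of i j]
      by (simp add: insert_commute)
    show "(case a of (i, j) \<Rightarrow> X $$ (i, j) * adj $$ (j, i)) =
        (case a of (i, j) \<Rightarrow> X $$ (i, j) * of_nat (w {i, j}))" if "a \<in> parcs G" for a
      using that arc by (cases a) (simp only: prod.case)
    show "\<forall>a\<in>{..<n} \<times> {..<n} - parcs G. (case a of (i, j) \<Rightarrow> X $$ (i, j) * adj $$ (j, i)) = 0"
      using arc_sym by (auto simp: adj_index)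
  qed simp
  finally show ?thesis .
qed

text \<open>The energy is the trace for an optimal unitary \<open>W\<close>; as it is real, only the
  real parts of the entries of \<open>W\<close> contribute.\<close>

lemma energy_eq_sum_unitary:
  obtains W where "unitary_mat n W"
    "energy (G, w) = (\<Sum>(i, j)\<in>parcs G. Re (W $$ (i, j)) * real (w {i, j}))"
proof -
  obtain W where W: "unitary_mat n W" "of_real (abs_eigenvalue_sum adj) = trace (W * adj)"
    using abs_eigenvalue_sum_eq_trace[OF adj_carrier adj_hermitian] .
  have "energy (G, w) = Re (of_real (abs_eigenvalue_sum adj))"
    by (simp add: energy_eq)
  also have "\<dots> = (\<Sum>(i, j)\<in>parcs G. Re (W $$ (i, j)) * real (w {i, j}))"
    unfolding W(2) trace_mult_adj[OF unitary_matD(1)[OF W(1)]]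
    by (simp add: case_prod_beta)
  finally show thesis
    using that W(1) by blast
qed

lemma Re_unitary_arc_le_1:
  assumes "unitary_mat n W" "(i, j) \<in> parcs G"
  shows "Re (W $$ (i, j)) \<le> 1"
  using cmod_unitary_mat_le_1[OF assms(1)] arc_less[OF assms(2)] complex_Re_le_cmod order_trans
  by blast

text \<open>Each arc contributes at most its weight, and every edge is counted through two
  arcs.\<close>

lemma energy_le: "energy (G, w) \<le> 2 * real m"
proof -
  obtain W where W: "unitary_mat n W"
    and energy: "energy (G, w) = (\<Sum>(i, j)\<in>parcs G. Re (W $$ (i, j)) * real (w {i, j}))"
    using energy_eq_sum_unitary .
  have "Re (W $$ (i, j)) * real (w {i, j}) \<le> real (w {i, j})" if "(i, j) \<in> parcs G" for i j
    using mult_right_mono[OF Re_unitary_arc_le_1[OF W that], of "real (w {i, j})"] by simp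
  then show ?thesis
    unfolding energy sum_arc_weights[symmetric] by (intro sum_mono) auto
qed

text \<open>Equality forces \<open>Re (W $$ (i, j)) = 1\<close> on every arc because weights are
  positive. Two neighbours of \<open>i\<close> would then give row \<open>i\<close> of
  \<open>W\<close> a squared norm of at least 2.\<close>

lemma energy_maximal_imp_single_valued:
  assumes "energy (G, w) = 2 * real m"
  shows "single_valued (parcs G)"
proof -
  obtain W where W: "unitary_mat n W"
    and energy: "energy (G, w) = (\<Sum>(i, j)\<in>parcs G. Re (W $$ (i, j)) * real (w {i, j}))"
    using energy_eq_sum_unitary .
  \<comment> \<open>The deficits of the arcs are nonnegative and sum to 0, so each of them
    vanishes.\<close>
  have "(\<Sum>a\<in>parcs G. (1 - Re (W $$ a)) * real (w {fst a, snd a})) = 0"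
    using assms sum_arc_weights unfolding energy
    by (simp add: left_diff_distrib sum_subtractf case_prod_beta)
  then have zero: "(1 - Re (W $$ a)) * real (w {fst a, snd a}) = 0" if "a \<in> parcs G" for a
    using that Re_unitary_arc_le_1[OF W] pair_finite_arcs
    by (subst (asm) sum_nonneg_eq_0_iff) (auto simp del: mult_eq_0_iff)
  have Re_1: "Re (W $$ (i, j)) = 1" if "(i, j) \<in> parcs G" for i j
    using zero[OF that] weight_pos[OF that] by simp
  show ?thesis
  proof (rule single_valuedI, rule ccontr)
    fix i j k
    assume arcs: "(i, j) \<in> parcs G" "(i, k) \<in> parcs G" and "j \<noteq> k"
    have ge_1: "1 \<le> (cmod (W $$ (i, l)))\<^sup>2" if "(i, l) \<in> parcs G" for l
      using Re_1[OF that] complex_Re_le_cmod[of "W $$ (i, l)"] by simp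
    have "2 \<le> (\<Sum>l\<in>{j, k}. (cmod (W $$ (i, l)))\<^sup>2)"
      using ge_1[OF arcs(1)] ge_1[OF arcs(2)] \<open>j \<noteq> k\<close> by simp
    also have "\<dots> \<le> (\<Sum>l<n. (cmod (W $$ (i, l)))\<^sup>2)"
      using arcs arc_less by (intro sum_mono2) auto
    also have "\<dots> = 1"
      using arcs arc_less by (intro unitary_mat_row_norm[OF W]) auto
    finally show False
      by simp
  qed
qed

text \<open>The permutation matrix \<open>P\<close> that swaps matched vertices is unitary and has
  the entry 1 on every arc, so \<open>trace (P * adj)\<close> collects all arc weights, that is,
  \<open>2 * m\<close>.\<close>

lemma energy_single_valued:
  assumes sv: "single_valued (parcs G)"
  shows "energy (G, w) = 2 * real m"
proof (rule antisym[OF energy_le])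
  \<comment> \<open>Sends a vertex to its partner; fixing every other number makes \<sigma> an
    involution.\<close>
  define \<sigma> where "\<sigma> i = (if i \<in> Domain (parcs G) then THE j. (i, j) \<in> parcs G else i)" for i
  have \<sigma>_arc: "\<sigma> i = j" if "(i, j) \<in> parcs G" for i j
    using that sv by (auto simp: \<sigma>_def dest: single_valuedD)
  have \<sigma>_isolated: "\<sigma> i = i" if "i \<notin> Domain (parcs G)" for i
    using that by (simp add: \<sigma>_def)
  have \<sigma>: "\<sigma> (\<sigma> i) = i \<and> (i < n \<longrightarrow> \<sigma> i < n)" for i
  proof (cases "i \<in> Domain (parcs G)")
    case True
    then obtain j where j: "(i, j) \<in> parcs G" "(j, i) \<in> parcs G"
      using arc_sym by blast
    then show ?thesis
      using arc_less(2)[OF j(1)] by (simp add: \<sigma>_arc[OF j(1)] \<sigma>_arc[OF j(2)])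
  next
    case False
    then show ?thesis
      by (simp add: \<sigma>_isolated)
  qed
  define P :: "complex mat" where "P = mat n n (\<lambda>(i, j). if j = \<sigma> i then 1 else 0)"
  have P: "P \<in> carrier_mat n n"
    by (simp add: P_def)
  have "mat_adjoint P * P = 1\<^sub>m n"
  proof (rule eq_matI)
    fix i j
    assume "i < dim_row (1\<^sub>m n :: complex mat)" "j < dim_col (1\<^sub>m n :: complex mat)"
    then have i: "i < n" and j: "j < n"
      by simp_all
    have "(mat_adjoint P * P) $$ (i, j) =
        (\<Sum>k\<in>{0..<n}. cnj (if i = \<sigma> k then 1 else 0) * (if j = \<sigma> k then 1 else 0))"
      using i j by (simp add: P_def scalar_prod_def)
    \<comment> \<open>As \<sigma> is an involution, \<open>i = \<sigma> k\<close> means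
      \<open>k = \<sigma> i\<close>.\<close>
    also have "\<dots> = (\<Sum>k\<in>{0..<n}. if k = \<sigma> i then (if i = j then 1 else 0) else 0)"
      by (intro sum.cong refl) (metis (full_types) \<sigma> complex_cnj_one complex_cnj_zero mult_1 mult_zero_left mult_zero_right)
    finally show "(mat_adjoint P * P) $$ (i, j) = 1\<^sub>m n $$ (i, j)"
      using i j \<sigma>[of i] by simp
  qed (simp_all add: P_def)
  then have "unitary_mat n P"
    using P by (simp add: unitary_mat_def)
  have "trace (P * adj) = (\<Sum>(i, j)\<in>parcs G. of_nat (w {i, j}))"
    unfolding trace_mult_adj[OF P]
    by (intro sum.cong) (use arc_less in \<open>auto simp: P_def \<sigma>_arc\<close>)
  also have "\<dots> = of_real (\<Sum>(i, j)\<in>parcs G. real (w {i, j}))"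
    by (simp add: case_prod_beta)
  finally have "cmod (trace (P * adj)) = 2 * real m"
    unfolding sum_arc_weights by simp
  then show "2 * real m \<le> energy (G, w)"
    using cmod_trace_unitary_mult_le[OF adj_carrier adj_hermitian \<open>unitary_mat n P\<close>]
    by (simp add: energy_eq)
qed

end

text \<open>A matching with total weight \<open>m\<close>, showing that the bound
  \<open>2 * m\<close> is attained: all weight sits on one edge, for which \<open>n \<ge> 2\<close>
  provides the endpoints and \<open>m \<ge> 1\<close> the positive weight.\<close>

lemma single_edge_in_weighted_forests:
  assumes "n \<ge> 2" "m \<ge> 1"
  shows "(\<lparr>pverts = {0..<n}, parcs = {(0, 1), (1, 0)}\<rparr>, \<lambda>_. m) \<in> weighted_forests n m"
proof -
  define G :: "nat pair_pre_digraph" where "G = \<lparr>pverts = {0..<n}, parcs = {(0, 1), (1, 0)}\<rparr>"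
  interpret pair_graph G
    using assms(1) by unfold_locales (auto simp: G_def symmetric_def sym_def)
  have "length p < 3" if cyc: "pre_digraph.cycle (with_proj G) p" for p
  proof (rule ccontr)
    assume "\<not> length p < 3"
    \<comment> \<open>Three consecutive arcs must alternate between the two available ones, so the
      vertices after the start begin with some \<open>v\<close>, \<open>u\<close>, \<open>v\<close>
      and are not distinct.\<close>
    then obtain a b c q where p: "p = a # b # c # q"
      by (cases p; cases "tl p"; cases "tl (tl p)") auto
    obtain u where "awalk u p u" and dist: "distinct (tl (pawalk_verts u p))"
      using cyc by (auto simp: cycle_def)
    then have "set p \<subseteq> parcs G" "pcas u p u"
      by (auto simp: awalk_def)
    then have "set p \<subseteq> {(0, 1), (1, 0)}" "pcas u p u"
      by (simp_all add: G_def)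
    with dist show False
      unfolding p by (cases q) auto
  qed
  then have "undirected_forest G"
    unfolding undirected_forest_def using pair_graph_axioms by force
  moreover have "edges G = {{0, 1}}"
    by (auto simp: edges_def G_def)
  ultimately show ?thesis
    using assms(2) by (simp add: weighted_forests_def flip: G_def) (simp add: G_def)
qed

theorem theorem5:
  fixes n m :: nat and F :: weighted_graph
  assumes "n \<ge> 2" and "m \<ge> 1"
    and "F \<in> weighted_forests n m"
  shows "((\<forall>F'\<in>weighted_forests n m. energy F' \<le> energy F) \<longleftrightarrow>
            (\<forall>C\<in>components F. complete_digraph 1 C \<or> complete_digraph 2 C)) \<and>
         ((\<forall>C\<in>components F. complete_digraph 1 C \<or> complete_digraph 2 C) \<longrightarrow>
            energy F = 2 * real m)"
proof -
  obtain G w where F: "F = (G, w)"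
    by (cases F)
  interpret weighted_forest n m G w
    using assms(3) by unfold_locales (simp add: F)
  have bound: "energy F' \<le> 2 * real m" if "F' \<in> weighted_forests n m" for F'
    using that weighted_forest.energy_le weighted_forest.intro by (cases F') blast
  define F\<^sub>0 :: weighted_graph where
    "F\<^sub>0 = (\<lparr>pverts = {0..<n}, parcs = {(0, 1), (1, 0)}\<rparr>, \<lambda>_. m)"
  have F\<^sub>0: "F\<^sub>0 \<in> weighted_forests n m"
    unfolding F\<^sub>0_def by (rule single_edge_in_weighted_forests[OF assms(1,2)])
  then have "energy F\<^sub>0 = 2 * real m"
    unfolding F\<^sub>0_def
    by (intro weighted_forest.energy_single_valued weighted_forest.intro)
      (auto simp: single_valued_def)
  \<comment> \<open>\<open>F\<^sub>0\<close> attains the upper bound, so the maximum energy is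
    exactly \<open>2 * m\<close>.\<close>
  then have "(\<forall>F'\<in>weighted_forests n m. energy F' \<le> energy F) \<longleftrightarrow> energy F = 2 * real m"
    using bound F\<^sub>0 assms(3) by (metis antisym)
  also have "\<dots> \<longleftrightarrow> single_valued (parcs G)"
    unfolding F using energy_maximal_imp_single_valued energy_single_valued by blast
  finally show ?thesis
    using energy_single_valued
    unfolding F small_components_iff_single_valued[OF pair_graph_axioms] by blast
qed

end
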